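(* Let $K$ be a field, $m<n$ positive integers, and $a_m(t),\dots,a_n(t)$ Dirichlet polynomials in the indeterminate $t$ over $K$ with $a_ma_n\ne0$ and $\deg a_m\ne\deg a_n$. Let $f(s,t)=\sum_{i=m}^n\frac{a_i(t)}{i^s}$ and assume $f$ is algebraically primitive. Let $d_1=\gcd\{\nu_p(m)-\nu_p(n): p\text{ prime},\ p\mid mn\}$ and $d_2=\gcd\{\nu_p(\deg a_m)-\nu_p(\deg a_n): p\text{ prime},\ p\mid \deg a_m\cdot\deg a_n\}$. If $\deg a_i<(\deg a_m)^{\log_{n/m}(n/i)}(\deg a_n)^{1-\log_{n/m}(n/i)}$ for all $m<i<n$ and $\gcd(d_1,d_2)=1$, then $f$ is irreducible.
   Context: Bivariate Dirichlet polynomials over $K$ are finite sums $\sum\frac{c_{i,j}}{i^sj^t}$ ($i,j$ positive integers) with product $\frac{c}{i^sj^t}\cdot\frac{d}{k^s\ell^t}=\frac{cd}{(ik)^s(j\ell)^t}$ extended bilinearly; constant means supported on $\{(1,1)\}$; algebraically primitive means having no nonconstant factor consisting of a single term. For a univariate Dirichlet polynomial $a(t)=\sum_j\frac{c_j}{j^t}$, $\deg a$ is the largest $j$ with $c_j\ne0$, and the zero polynomial has degree $0$. $\nu_p$ is the $p$-adic valuation. Irreducible means not a product of two nonconstant bivariate Dirichlet polynomials over $K$.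
   Formalization: "Single term" in "algebraically primitive" is read as b(t)/i^s with b a Dirichlet polynomial in t, not only c/(i^s j^t); with monomials only the claim fails, e.g. for (1+1/2^t)(1+1/(2^s 3^t)). *)

theory Defs
  imports Complex_Main "HOL-Computational_Algebra.Primes"
begin

text \<open>
  A univariate Dirichlet polynomial \<open>\<Sum>\<^sub>j c\<^sub>j / j\<^sup>t\<close> is represented by its coefficient function
  \<open>j \<mapsto> c\<^sub>j\<close>, a bivariate one \<open>\<Sum> c\<^sub>i\<^sub>j / (i\<^sup>s j\<^sup>t)\<close> by \<open>i \<mapsto> j \<mapsto> c\<^sub>i\<^sub>j\<close>; so \<open>f i\<close> is the coefficient
  \<open>a\<^sub>i(t)\<close> of \<open>1 / i\<^sup>s\<close>. Since indices are positive, coefficients at index 0 vanish.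
\<close>

definition dirichlet_poly :: "(nat \<Rightarrow> 'a::zero) \<Rightarrow> bool" where
  "dirichlet_poly a \<longleftrightarrow> finite {j. a j \<noteq> 0} \<and> (\<forall>j. a j \<noteq> 0 \<longrightarrow> j > 0)"

definition dirichlet_deg :: "(nat \<Rightarrow> 'a::zero) \<Rightarrow> nat" where
  "dirichlet_deg a = (if \<forall>j. a j = 0 then 0 else Max {j. a j \<noteq> 0})"

definition bsupport :: "(nat \<Rightarrow> nat \<Rightarrow> 'a::zero) \<Rightarrow> (nat \<times> nat) set" where
  "bsupport f = {(i, j). f i j \<noteq> 0}"

definition bdirichlet_poly :: "(nat \<Rightarrow> nat \<Rightarrow> 'a::zero) \<Rightarrow> bool" where
  "bdirichlet_poly f \<longleftrightarrow> finite (bsupport f) \<and> (\<forall>(i, j) \<in> bsupport f. i > 0 \<and> j > 0)"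

text \<open>
  The bilinear extension of \<open>c/(i\<^sup>s j\<^sup>t) \<cdot> d/(k\<^sup>s l\<^sup>t) = cd/((ik)\<^sup>s (jl)\<^sup>t)\<close>; meaningful for finitely
  supported arguments.
\<close>

definition bdirichlet_mult ::
    "(nat \<Rightarrow> nat \<Rightarrow> 'a::comm_semiring_0) \<Rightarrow> (nat \<Rightarrow> nat \<Rightarrow> 'a) \<Rightarrow> nat \<Rightarrow> nat \<Rightarrow> 'a" where
  "bdirichlet_mult g h = (\<lambda>u v. \<Sum>(i, j) \<in> bsupport g. \<Sum>(k, l) \<in> bsupport h.
      if i * k = u \<and> j * l = v then g i j * h k l else 0)"

definition bdirichlet_constant :: "(nat \<Rightarrow> nat \<Rightarrow> 'a::zero) \<Rightarrow> bool" where
  "bdirichlet_constant f \<longleftrightarrow> bsupport f \<subseteq> {(1, 1)}"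

definition bdirichlet_irreducible :: "(nat \<Rightarrow> nat \<Rightarrow> 'a::comm_semiring_0) \<Rightarrow> bool" where
  "bdirichlet_irreducible f \<longleftrightarrow>
     \<not> (\<exists>g h. bdirichlet_poly g \<and> bdirichlet_poly h \<and>
          \<not> bdirichlet_constant g \<and> \<not> bdirichlet_constant h \<and> f = bdirichlet_mult g h)"

text \<open>
  Terms are those of \<open>f = \<Sum>\<^sub>i a\<^sub>i(t)/i\<^sup>s\<close>, regarded as a Dirichlet polynomial in \<open>s\<close> whose coefficients
  are Dirichlet polynomials in \<open>t\<close>: a single term is \<open>b(t)/i\<^sup>s\<close>. Hence an algebraically primitive \<open>f\<close>
  has no nonconstant factor \<open>b(t)\<close>. Excluding only monomial factors \<open>c/(i\<^sup>s j\<^sup>t)\<close> would not suffice for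
  an irreducibility criterion on the degrees of the \<open>a\<^sub>i\<close>: consider
  \<open>(1 + 1/2\<^sup>t) (1 + 1/(2\<^sup>s 3\<^sup>t))\<close>.
\<close>

definition single_term :: "(nat \<Rightarrow> nat \<Rightarrow> 'a::zero) \<Rightarrow> bool" where
  "single_term g \<longleftrightarrow>
     (\<exists>i b. i > 0 \<and> dirichlet_poly b \<and> g = (\<lambda>k l. if k = i then b l else 0))"

definition algebraically_primitive :: "(nat \<Rightarrow> nat \<Rightarrow> 'a::comm_semiring_0) \<Rightarrow> bool" where
  "algebraically_primitive f \<longleftrightarrow>
     \<not> (\<exists>g h. bdirichlet_poly g \<and> bdirichlet_poly h \<and>
          single_term g \<and> \<not> bdirichlet_constant g \<and> f = bdirichlet_mult g h)"

definition valuation_gcd :: "nat \<Rightarrow> nat \<Rightarrow> int" where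
  "valuation_gcd u v =
     Gcd {int (multiplicity p u) - int (multiplicity p v) | p. prime p \<and> p dvd u * v}"

end

theory Submission
  imports Defs "HOL-Library.Product_Lexorder"
begin

text \<open>
  Regard terms \<open>1/(i\<^sup>s j\<^sup>t)\<close> as points of the free abelian group on two copies of the primes. The
  degree condition says that some additive functional attains its maximum over the support of \<open>f\<close>
  at exactly two points, \<open>u = (m, deg a\<^sub>m)\<close> and \<open>v = (n, deg a\<^sub>n)\<close>, so the segment \<open>uv\<close> is an edge
  of the Newton polytope. If \<open>f = g h\<close>, then \<open>g\<close> has terms \<open>u\<^sub>g\<close>, \<open>v\<^sub>g\<close> such that \<open>v\<^sub>g - u\<^sub>g\<close> is
  \<open>\<theta> (v - u)\<close> for some real \<open>\<theta>\<close>, and primitivity of \<open>f\<close> forces \<open>0 < \<theta> < 1\<close>. But \<open>v - u\<close> has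
  integer coordinates with greatest common divisor \<open>gcd d\<^sub>1 d\<^sub>2 = 1\<close>, and \<open>\<theta> (v - u)\<close> is integral,
  so \<open>\<theta>\<close> is an integer.
\<close>

section \<open>Leading terms of products\<close>

definition pos_pairs :: "(nat \<times> nat) set" where
  "pos_pairs = {0<..} \<times> {0<..}"

definition pmul :: "nat \<times> nat \<Rightarrow> nat \<times> nat \<Rightarrow> nat \<times> nat" where
  "pmul p q = (fst p * fst q, snd p * snd q)"

text \<open>A monomial order on the terms, encoded by an injective key into a linear order so that
  different orders can be built lexicographically and compared on the same support.\<close>

definition multiplicative_key :: "(nat \<times> nat \<Rightarrow> 'k::linorder) \<Rightarrow> bool" where
  "multiplicative_key K \<longleftrightarrow> inj_on K pos_pairs \<and>
     (\<forall>p\<in>pos_pairs. \<forall>p'\<in>pos_pairs. \<forall>q\<in>pos_pairs. K p < K p' \<longrightarrow> K (pmul p q) < K (pmul p' q))"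

definition leading :: "(nat \<times> nat \<Rightarrow> 'k::linorder) \<Rightarrow> (nat \<times> nat) set \<Rightarrow> nat \<times> nat \<Rightarrow> bool" where
  "leading K S p \<longleftrightarrow> p \<in> S \<and> (\<forall>q\<in>S. K q \<le> K p)"

lemma pmul_commute: "pmul p q = pmul q p"
  by (simp add: pmul_def mult.commute)

lemma pmul_in_pos_pairs: "p \<in> pos_pairs \<Longrightarrow> q \<in> pos_pairs \<Longrightarrow> pmul p q \<in> pos_pairs"
  by (auto simp: pmul_def pos_pairs_def)

lemma bdirichlet_poly_iff:
  "bdirichlet_poly f \<longleftrightarrow> finite (bsupport f) \<and> bsupport f \<subseteq> pos_pairs"
  by (auto simp: bdirichlet_poly_def pos_pairs_def)

lemma bdirichlet_mult_alt:
  "bdirichlet_mult g h = (\<lambda>u v. \<Sum>p\<in>bsupport g. \<Sum>q\<in>bsupport h.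
     if pmul p q = (u, v) then g (fst p) (snd p) * h (fst q) (snd q) else 0)"
  by (simp add: bdirichlet_mult_def split_def pmul_def)

lemma bdirichlet_mult_commute: "bdirichlet_mult g h = bdirichlet_mult h g"
  unfolding bdirichlet_mult_alt
  by (subst sum.swap) (simp add: pmul_commute mult.commute cong: if_cong)

lemma bsupport_mult_subset:
  assumes "r \<in> bsupport (bdirichlet_mult g h)"
  obtains p q where "p \<in> bsupport g" "q \<in> bsupport h" "r = pmul p q"
proof -
  obtain u v where r: "r = (u, v)" by fastforce
  have "(\<Sum>p\<in>bsupport g. \<Sum>q\<in>bsupport h.
     if pmul p q = (u, v) then g (fst p) (snd p) * h (fst q) (snd q) else 0) \<noteq> 0"
    using assms by (simp add: r bsupport_def bdirichlet_mult_alt)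
  then obtain p where p: "p \<in> bsupport g" and "(\<Sum>q\<in>bsupport h.
     if pmul p q = (u, v) then g (fst p) (snd p) * h (fst q) (snd q) else 0) \<noteq> 0"
    by (rule sum.not_neutral_contains_not_neutral)
  from this(2) obtain q where "q \<in> bsupport h"
    "(if pmul p q = (u, v) then g (fst p) (snd p) * h (fst q) (snd q) else 0) \<noteq> 0"
    by (rule sum.not_neutral_contains_not_neutral)
  with p show ?thesis using that r by (simp split: if_splits)
qed

text \<open>The factors are replaced one at a time, and each replacement by a different factor
  raises the key strictly. Hence equal products leave no room for a change in either factor.\<close>

lemma multiplicative_key_mono:
  assumes K: "multiplicative_key K"
    and pos: "p \<in> pos_pairs" "q \<in> pos_pairs" "p' \<in> pos_pairs" "q' \<in> pos_pairs"
    and le: "K p \<le> K p'" "K q \<le> K q'"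
  shows "K (pmul p q) \<le> K (pmul p' q')"
    and "pmul p q = pmul p' q' \<Longrightarrow> p = p' \<and> q = q'"
proof -
  have inj: "\<And>x y. x \<in> pos_pairs \<Longrightarrow> y \<in> pos_pairs \<Longrightarrow> K x = K y \<Longrightarrow> x = y"
    using K by (auto simp: multiplicative_key_def inj_on_def)
  have 1: "p = p' \<or> K (pmul p q) < K (pmul p' q)"
    using K pos le inj[of p p'] unfolding multiplicative_key_def by (metis order_le_less)
  have 2: "q = q' \<or> K (pmul p' q) < K (pmul p' q')"
    using K pos le inj[of q q'] unfolding multiplicative_key_def
    by (metis order_le_less pmul_commute)
  show "K (pmul p q) \<le> K (pmul p' q')"
    using 1 2 by (metis less_imp_le order.refl order.trans)
  show "pmul p q = pmul p' q' \<Longrightarrow> p = p' \<and> q = q'"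
    using 1 2 by (metis less_irrefl less_trans)
qed

lemma leading_exists:
  assumes "finite S" "S \<noteq> {}"
  shows "\<exists>p. leading K S p"
proof -
  have "Max (K ` S) \<in> K ` S" using assms by simp
  then obtain p where "p \<in> S" "K p = Max (K ` S)" by auto
  with assms have "leading K S p" by (simp add: leading_def)
  then show ?thesis ..
qed

lemma leading_unique:
  assumes "multiplicative_key K" "S \<subseteq> pos_pairs" "leading K S p" "leading K S q"
  shows "p = q"
proof -
  have "K p = K q" using assms by (auto simp: leading_def intro: antisym)
  with assms show ?thesis unfolding leading_def multiplicative_key_def by (meson inj_onD subsetD)
qed

text \<open>No other pair of terms multiplies to \<open>pmul p q\<close>, so nothing cancels there
  and the coefficient is a product of two nonzero field elements.\<close>

lemma leading_mult:
  fixes g h :: "nat \<Rightarrow> nat \<Rightarrow> 'a::field"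
  assumes K: "multiplicative_key K"
    and g: "bdirichlet_poly g" and h: "bdirichlet_poly h"
    and p: "leading K (bsupport g) p" and q: "leading K (bsupport h) q"
  shows "leading K (bsupport (bdirichlet_mult g h)) (pmul p q)"
proof -
  have fin: "finite (bsupport g)" "finite (bsupport h)"
    and pos: "bsupport g \<subseteq> pos_pairs" "bsupport h \<subseteq> pos_pairs"
    using g h by (auto simp: bdirichlet_poly_iff)
  have pS: "p \<in> bsupport g" and qS: "q \<in> bsupport h"
    and p_max: "\<And>x. x \<in> bsupport g \<Longrightarrow> K x \<le> K p"
    and q_max: "\<And>x. x \<in> bsupport h \<Longrightarrow> K x \<le> K q"
    using p q by (auto simp: leading_def)
  have "pmul x y = pmul p q \<longleftrightarrow> x = p \<and> y = q" if "x \<in> bsupport g" "y \<in> bsupport h" for x y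
    using multiplicative_key_mono(2)[OF K _ _ _ _ p_max[OF that(1)] q_max[OF that(2)]]
      subsetD[OF pos(1) pS] subsetD[OF pos(2) qS] subsetD[OF pos(1) that(1)] subsetD[OF pos(2) that(2)]
    by metis
  then have "bdirichlet_mult g h (fst (pmul p q)) (snd (pmul p q)) =
      (\<Sum>x\<in>bsupport g. \<Sum>y\<in>bsupport h. if x = p \<and> y = q then g (fst p) (snd p) * h (fst q) (snd q) else 0)"
    unfolding bdirichlet_mult_alt prod.collapse
    by (intro sum.cong refl if_cong) auto
  also have "\<dots> = (\<Sum>x\<in>bsupport g. if x = p then g (fst p) (snd p) * h (fst q) (snd q) else 0)"
  proof (intro sum.cong refl)
    fix x
    show "(\<Sum>y\<in>bsupport h. if x = p \<and> y = q then g (fst p) (snd p) * h (fst q) (snd q) else 0) =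
        (if x = p then g (fst p) (snd p) * h (fst q) (snd q) else 0)"
      using fin qS by (cases "x = p") simp_all
  qed
  also have "\<dots> = g (fst p) (snd p) * h (fst q) (snd q)" using fin pS by simp
  also have "\<dots> \<noteq> 0" using pS qS by (simp add: bsupport_def split_def)
  finally have "pmul p q \<in> bsupport (bdirichlet_mult g h)"
    by (simp add: bsupport_def split_def)
  moreover have "K r \<le> K (pmul p q)" if r: "r \<in> bsupport (bdirichlet_mult g h)" for r
  proof -
    obtain x y where xy: "x \<in> bsupport g" "y \<in> bsupport h" "r = pmul x y"
      using r by (rule bsupport_mult_subset)
    show ?thesis unfolding xy(3)
      by (rule multiplicative_key_mono(1)[OF K])
        (use pos pS qS xy(1,2) p_max[OF xy(1)] q_max[OF xy(2)] in \<open>simp_all add: subsetD\<close>)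
  qed
  ultimately show ?thesis by (simp add: leading_def)
qed

text \<open>The \<open>L\<close>-leading terms of \<open>g\<close> and \<open>h\<close> also
  multiply to \<open>u\<close>. Since \<open>p\<close> and \<open>q\<close> are
  \<open>K\<close>-maximal, \<open>u\<close> splits over the two supports only as
  \<open>pmul p q\<close>, so both choices agree.\<close>

lemma leading_factor:
  fixes g h :: "nat \<Rightarrow> nat \<Rightarrow> 'a::field"
  assumes K: "multiplicative_key K" and L: "multiplicative_key L"
    and g: "bdirichlet_poly g" and h: "bdirichlet_poly h"
    and uK: "leading K (bsupport (bdirichlet_mult g h)) u"
    and uL: "leading L (bsupport (bdirichlet_mult g h)) u"
    and p: "leading K (bsupport g) p" and q: "leading K (bsupport h) q"
  shows "leading L (bsupport g) p"
proof -
  have fin: "finite (bsupport g)" "finite (bsupport h)"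
    and pos: "bsupport g \<subseteq> pos_pairs" "bsupport h \<subseteq> pos_pairs"
    using g h by (auto simp: bdirichlet_poly_iff)
  have posm: "bsupport (bdirichlet_mult g h) \<subseteq> pos_pairs"
    using pos by (blast elim: bsupport_mult_subset intro: pmul_in_pos_pairs)
  obtain p' where p': "leading L (bsupport g) p'"
    using leading_exists[OF fin(1), of L] p by (auto simp: leading_def)
  obtain q' where q': "leading L (bsupport h) q'"
    using leading_exists[OF fin(2), of L] q by (auto simp: leading_def)
  have "pmul p q = u"
    using leading_unique[OF K posm leading_mult[OF K g h p q] uK] .
  moreover have "pmul p' q' = u"
    using leading_unique[OF L posm leading_mult[OF L g h p' q'] uL] .
  ultimately have "p' = p"
    using multiplicative_key_mono(2)[OF K, of p' q' p q] p q p' q' pos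
    unfolding leading_def by (metis subsetD)
  with p' show ?thesis by simp
qed

section \<open>Factors along an edge of the Newton polytope\<close>

definition additive_on_pairs :: "(nat \<times> nat \<Rightarrow> real) \<Rightarrow> bool" where
  "additive_on_pairs X \<longleftrightarrow> (\<forall>p\<in>pos_pairs. \<forall>q\<in>pos_pairs. X (pmul p q) = X p + X q)"

text \<open>The logarithms serve to make the key injective on \<open>pos_pairs\<close> when
  \<open>s\<close> is nonzero. The sign of \<open>s\<close> decides whether a small or a large first
  index wins a tie in \<open>X\<close> and \<open>Y\<close>; any remaining tie goes to the larger
  second index.\<close>

definition lex_key ::
    "(nat \<times> nat \<Rightarrow> real) \<Rightarrow> (nat \<times> nat \<Rightarrow> real) \<Rightarrow> real \<Rightarrow> nat \<times> nat \<Rightarrow> real \<times> real \<times> real \<times> real" where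
  "lex_key X Y s p = (X p, Y p, s * ln (real (fst p)), ln (real (snd p)))"

lemma additive_on_pairs_zero: "additive_on_pairs (\<lambda>_. 0)"
  by (simp add: additive_on_pairs_def)

lemma additive_on_pairs_lincomb:
  "additive_on_pairs X \<Longrightarrow> additive_on_pairs Y \<Longrightarrow> additive_on_pairs (\<lambda>p. c * X p + d * Y p)"
  by (simp add: additive_on_pairs_def algebra_simps)

lemma additive_on_pairs_ln:
  "additive_on_pairs (\<lambda>p. ln (real (fst p)))" "additive_on_pairs (\<lambda>p. ln (real (snd p)))"
  by (auto simp: additive_on_pairs_def pmul_def pos_pairs_def ln_mult)

lemma additive_on_pairs_multiplicity:
  assumes "prime q"
  shows "additive_on_pairs (\<lambda>p. real (multiplicity q (fst p)))"
    and "additive_on_pairs (\<lambda>p. real (multiplicity q (snd p)))"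
  using assms
  by (auto simp: additive_on_pairs_def pmul_def pos_pairs_def prime_elem_multiplicity_mult_distrib)

lemma multiplicative_key_lex_key:
  assumes X: "additive_on_pairs X" and Y: "additive_on_pairs Y" and s: "s \<noteq> 0"
  shows "multiplicative_key (lex_key X Y s)"
  unfolding multiplicative_key_def
proof (intro conjI ballI impI)
  show "inj_on (lex_key X Y s) pos_pairs"
    using s by (auto simp: inj_on_def lex_key_def pos_pairs_def)
next
  fix p p' q
  assume pos: "p \<in> pos_pairs" "p' \<in> pos_pairs" "q \<in> pos_pairs"
    and lt: "lex_key X Y s p < lex_key X Y s p'"
  have eq: "lex_key X Y s (pmul r q) = (X r + X q, Y r + Y q,
      s * ln (real (fst r)) + s * ln (real (fst q)), ln (real (snd r)) + ln (real (snd q)))"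
    if "r \<in> pos_pairs" for r
    using X Y additive_on_pairs_ln that pos(3)
    by (auto simp: additive_on_pairs_def lex_key_def algebra_simps)
  show "lex_key X Y s (pmul p q) < lex_key X Y s (pmul p' q)"
    using lt unfolding eq[OF pos(1)] eq[OF pos(2)] by (auto simp: lex_key_def)
qed

text \<open>
  By \<open>leading_factor\<close> the extreme terms of \<open>g\<close> are the same for every key that makes \<open>u\<close> (resp. \<open>v\<close>)
  leading in the product. As \<open>X\<close> and \<open>Y\<close> do not separate \<open>u\<close> from \<open>v\<close>, the keys with and without
  \<open>X, Y\<close> can be compared, for both signs of the tie-breaker.
\<close>

lemma edge_factor:
  fixes g h :: "nat \<Rightarrow> nat \<Rightarrow> 'a::field"
  assumes X: "additive_on_pairs X" and Y: "additive_on_pairs Y"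
    and g: "bdirichlet_poly g" and h: "bdirichlet_poly h"
    and S: "S = bsupport (bdirichlet_mult g h)"
    and u: "leading (lex_key (\<lambda>_. 0) (\<lambda>_. 0) (-1)) S u"
    and v: "leading (lex_key (\<lambda>_. 0) (\<lambda>_. 0) 1) S v"
    and XY: "X u = X v" "Y u = Y v" and edge: "\<And>p. p \<in> S \<Longrightarrow> p \<noteq> u \<Longrightarrow> p \<noteq> v \<Longrightarrow> X p < X u"
    and ug: "leading (lex_key (\<lambda>_. 0) (\<lambda>_. 0) (-1)) (bsupport g) ug"
    and vg: "leading (lex_key (\<lambda>_. 0) (\<lambda>_. 0) 1) (bsupport g) vg"
    and uh: "leading (lex_key (\<lambda>_. 0) (\<lambda>_. 0) (-1)) (bsupport h) uh"
    and vh: "leading (lex_key (\<lambda>_. 0) (\<lambda>_. 0) 1) (bsupport h) vh"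
  shows "Y ug = Y vg"
proof -
  note key0 = multiplicative_key_lex_key[OF additive_on_pairs_zero additive_on_pairs_zero]
  have face: "X p < X u \<or> X p = X u \<and> Y p = Y u" if "p \<in> S" for p
    using edge[OF that] XY by metis
  have "lex_key X Y (-1) p \<le> lex_key X Y (-1) u" if "p \<in> S" for p
    using face[OF that] u that by (auto simp: leading_def lex_key_def)
  then have uS: "leading (lex_key X Y (-1)) S u" using u by (auto simp: leading_def)
  have "lex_key X Y 1 p \<le> lex_key X Y 1 v" if "p \<in> S" for p
    using face[OF that] v XY that by (auto simp: leading_def lex_key_def)
  then have vS: "leading (lex_key X Y 1) S v" using v by (auto simp: leading_def)
  have "leading (lex_key X Y (-1)) (bsupport g) ug"
    by (rule leading_factor[OF key0 multiplicative_key_lex_key[OF X Y] g h _ _ ug uh])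
      (use u uS S in auto)
  moreover have "leading (lex_key X Y 1) (bsupport g) vg"
    by (rule leading_factor[OF key0 multiplicative_key_lex_key[OF X Y] g h _ _ vg vh])
      (use v vS S in auto)
  \<comment> \<open>Both inequalities are lexicographic: together they force equality in
    \<open>X\<close> and then in \<open>Y\<close>, whatever the tie-breakers are.\<close>
  ultimately have "lex_key X Y (-1) vg \<le> lex_key X Y (-1) ug" "lex_key X Y 1 ug \<le> lex_key X Y 1 vg"
    by (auto simp: leading_def)
  then show ?thesis by (auto simp: lex_key_def)
qed

text \<open>\<open>ug\<close> has the smallest first index and \<open>vg\<close> the largest, so
  \<open>ge\<close> leaves only one. Used in contrapositive form: a factor that is not a single term
  has two distinct extreme first indices.\<close>

lemma single_term_if_leading_eq:
  assumes g: "bdirichlet_poly g"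
    and ug: "leading (lex_key (\<lambda>_. 0) (\<lambda>_. 0) (-1)) (bsupport g) ug"
    and vg: "leading (lex_key (\<lambda>_. 0) (\<lambda>_. 0) 1) (bsupport g) vg"
    and ge: "fst vg \<le> fst ug"
  shows "single_term g"
proof -
  have pos: "\<And>i j. g i j \<noteq> 0 \<Longrightarrow> 0 < i \<and> 0 < j" and fin: "finite (bsupport g)"
    using g by (auto simp: bdirichlet_poly_def bsupport_def)
  have ugS: "ug \<in> bsupport g" and vgS: "vg \<in> bsupport g"
    using ug vg by (auto simp: leading_def)
  then have up: "0 < fst ug" "0 < fst vg" using pos by (auto simp: bsupport_def)
  have eq: "i = fst ug" if "g i j \<noteq> 0" for i j
  proof -
    have "(i, j) \<in> bsupport g" using that by (simp add: bsupport_def)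
    then have "lex_key (\<lambda>_. 0) (\<lambda>_. 0) (-1) (i, j) \<le> lex_key (\<lambda>_. 0) (\<lambda>_. 0) (-1) ug"
      "lex_key (\<lambda>_. 0) (\<lambda>_. 0) 1 (i, j) \<le> lex_key (\<lambda>_. 0) (\<lambda>_. 0) 1 vg"
      using ug vg by (auto simp: leading_def)
    then have "ln (real (fst ug)) \<le> ln (real i)" "ln (real i) \<le> ln (real (fst vg))"
      by (auto simp: lex_key_def)
    with up pos[OF that] ge show ?thesis by simp
  qed
  have "{j. g (fst ug) j \<noteq> 0} \<subseteq> snd ` bsupport g"
    by (force simp: bsupport_def)
  then have "dirichlet_poly (g (fst ug))"
    using fin pos by (auto simp: dirichlet_poly_def intro: finite_subset)
  moreover have "g = (\<lambda>k l. if k = fst ug then g (fst ug) l else 0)"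
    using eq by (intro ext) auto
  ultimately show ?thesis using up unfolding single_term_def by blast
qed

section \<open>Irreducibility\<close>

text \<open>A nonzero \<open>d\<close> makes \<open>\<theta>\<close> rational. In lowest terms its
  denominator divides every element of \<open>D\<close> and \<open>E\<close>, hence their gcd
  1.\<close>

lemma integral_scaling_of_coprime:
  fixes \<theta> :: real and D E :: "int set"
  assumes coprime: "gcd (Gcd D) (Gcd E) = 1" and int: "\<And>d. d \<in> D \<union> E \<Longrightarrow> \<theta> * of_int d \<in> \<int>"
  shows "\<theta> \<in> \<int>"
proof -
  have "\<not> D \<union> E \<subseteq> {0}"
    using coprime by (metis Gcd_0_iff Un_subset_iff gcd_0_left_int abs_zero zero_neq_one)
  then obtain d where d: "d \<in> D \<union> E" "d \<noteq> 0" by blast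
  then have "\<theta> = (\<theta> * of_int d) / of_int d" by simp
  also have "\<dots> \<in> \<rat>"
    using int[OF d(1)] Ints_subset_Rats by (intro Rats_divide) auto
  finally obtain a b where ab: "b > 0" "coprime a b" "\<theta> = of_int a / of_int b"
    by (rule Rats_cases')
  have "b dvd d" if dD: "d \<in> D \<union> E" for d
  proof -
    obtain k where "\<theta> * of_int d = of_int k" using int[OF dD] by (auto elim: Ints_cases)
    then have "real_of_int (a * d) = real_of_int (b * k)"
      using ab(1,3) by (simp add: field_simps)
    then have "b dvd a * d" by (simp only: of_int_eq_iff dvd_triv_left)
    with ab(2) show ?thesis by (simp add: coprime_commute coprime_dvd_mult_right_iff)
  qed
  then have "b dvd gcd (Gcd D) (Gcd E)" by (blast intro: gcd_greatest Gcd_greatest)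
  with ab coprime show ?thesis by simp
qed

lemma dirichlet_deg_props:
  assumes "dirichlet_poly b"
  shows "b j \<noteq> 0 \<Longrightarrow> 0 < j \<and> j \<le> dirichlet_deg b"
    and "b \<noteq> (\<lambda>_. 0) \<Longrightarrow> b (dirichlet_deg b) \<noteq> 0 \<and> 0 < dirichlet_deg b"
proof -
  have fin: "finite {j. b j \<noteq> 0}" and pos: "\<And>j. b j \<noteq> 0 \<Longrightarrow> 0 < j"
    using assms by (auto simp: dirichlet_poly_def)
  show "b j \<noteq> 0 \<Longrightarrow> 0 < j \<and> j \<le> dirichlet_deg b"
    using fin pos by (auto simp: dirichlet_deg_def)
  assume "b \<noteq> (\<lambda>_. 0)"
  then have ne: "{j. b j \<noteq> 0} \<noteq> {}" by auto
  then have "dirichlet_deg b = Max {j. b j \<noteq> 0}" by (auto simp: dirichlet_deg_def)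
  with Max_in[OF fin ne] show "b (dirichlet_deg b) \<noteq> 0 \<and> 0 < dirichlet_deg b" using pos by auto
qed

text \<open>The exponent is the weight \<theta> with
  \<open>ln i = \<theta> * ln m + (1 - \<theta>) * ln n\<close>. After taking logarithms, the bound
  says that \<open>(ln i, ln j)\<close> lies strictly below the chord from
  \<open>(ln m, ln A)\<close> to \<open>(ln n, ln B)\<close>.\<close>

lemma edge_inequality:
  fixes m i n j A B :: nat
  assumes "0 < m" "m < i" "i < n" "0 < j" "0 < A" "0 < B"
    and lt: "real j < real A powr log (real n / real m) (real n / real i) *
               real B powr (1 - log (real n / real m) (real n / real i))"
  shows "(ln A - ln B) * ln i + (ln n - ln m) * ln j < (ln A - ln B) * ln m + (ln n - ln m) * ln A"
proof -
  define \<theta> where "\<theta> = log (real n / real m) (real n / real i)"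
  have pos: "0 < ln (real n) - ln (real m)" using assms by simp
  have \<theta>: "(ln n - ln m) * \<theta> = ln n - ln i"
    using assms pos by (simp add: \<theta>_def log_def ln_div)
  have "ln j < ln (real A powr \<theta> * real B powr (1 - \<theta>))"
    using lt assms unfolding \<theta>_def[symmetric] by simp
  also have "\<dots> = \<theta> * ln A + (1 - \<theta>) * ln B"
    using assms by (simp add: ln_mult ln_powr)
  finally have "(ln n - ln m) * ln j < (ln n - ln m) * (\<theta> * ln A + (1 - \<theta>) * ln B)"
    using pos by (rule mult_strict_left_mono)
  also have "\<dots> = (ln n - ln m) * \<theta> * ln A + ((ln n - ln m) - (ln n - ln m) * \<theta>) * ln B"
    by (simp add: algebra_simps)
  also have "\<dots> = (ln n - ln i) * ln A + (ln i - ln m) * ln B"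
    unfolding \<theta> by simp
  finally show ?thesis by (simp add: algebra_simps)
qed

theorem theorem9p3:
  fixes a :: "nat \<Rightarrow> nat \<Rightarrow> 'a::field" and f :: "nat \<Rightarrow> nat \<Rightarrow> 'a"
    and m n :: nat and d1 d2 :: int
  assumes "0 < m" and "m < n"
    and "\<And>i. m \<le> i \<Longrightarrow> i \<le> n \<Longrightarrow> dirichlet_poly (a i)"
    and "a m \<noteq> (\<lambda>_. 0)" and "a n \<noteq> (\<lambda>_. 0)"
    and "dirichlet_deg (a m) \<noteq> dirichlet_deg (a n)"
    and "f = (\<lambda>i j. if m \<le> i \<and> i \<le> n then a i j else 0)"
    and "algebraically_primitive f"
    and "d1 = valuation_gcd m n"
    and "d2 = valuation_gcd (dirichlet_deg (a m)) (dirichlet_deg (a n))"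
    and "\<And>i. m < i \<Longrightarrow> i < n \<Longrightarrow>
          real (dirichlet_deg (a i)) <
            real (dirichlet_deg (a m)) powr log (real n / real m) (real n / real i) *
            real (dirichlet_deg (a n)) powr (1 - log (real n / real m) (real n / real i))"
    and "gcd d1 d2 = 1"
  shows "bdirichlet_irreducible f"
proof -
  note m = assms(1) and mn = assms(2) and f = assms(7)
  define A B where "A = dirichlet_deg (a m)" and "B = dirichlet_deg (a n)"
  define u v where "u = (m, A)" and "v = (n, B)"
  \<comment> \<open>In logarithmic coordinates \<open>X\<close> is the normal to the chord from
    \<open>u\<close> to \<open>v\<close>, oriented so that it grows with the second index.\<close>
  define X :: "nat \<times> nat \<Rightarrow> real" where
    "X = (\<lambda>p. (ln A - ln B) * ln (real (fst p)) + (ln n - ln m) * ln (real (snd p)))"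
  have A: "a m A \<noteq> 0" "0 < A" and B: "a n B \<noteq> 0" "0 < B"
    using dirichlet_deg_props(2)[OF assms(3)[of m]] dirichlet_deg_props(2)[OF assms(3)[of n]]
      assms(4,5) mn unfolding A_def B_def by auto
  have addX: "additive_on_pairs X"
    unfolding X_def by (intro additive_on_pairs_lincomb additive_on_pairs_ln)
  have Xuv: "X u = X v" by (simp add: X_def u_def v_def algebra_simps)
  have uS: "u \<in> bsupport f" and vS: "v \<in> bsupport f"
    using A B mn by (auto simp: bsupport_def f u_def v_def)
  have supp: "m \<le> i \<and> i \<le> n \<and> 0 < j \<and> j \<le> dirichlet_deg (a i)" if "(i, j) \<in> bsupport f" for i j
    using that dirichlet_deg_props(1)[OF assms(3)] by (auto simp: bsupport_def f split: if_splits)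
  \<comment> \<open>For first index \<open>m\<close> or \<open>n\<close> the second index is below
    the degree; strictly between them the degree hypothesis applies.\<close>
  have edge: "X p < X u" if "p \<in> bsupport f" "p \<noteq> u" "p \<noteq> v" for p
  proof -
    obtain i j where p: "p = (i, j)" by fastforce
    note ij = supp[OF that(1)[unfolded p]]
    have lnpos: "0 < ln (real n) - ln (real m)" using m mn by simp
    consider "i = m" | "i = n" | "m < i" "i < n" using ij by linarith
    then show ?thesis
    proof cases
      case 1
      with ij that have "j < A" by (auto simp: p u_def A_def)
      with 1 ij lnpos show ?thesis by (auto simp: X_def p u_def)
    next
      case 2
      with ij that have "j < B" by (auto simp: p v_def B_def)
      with 2 ij lnpos show ?thesis unfolding Xuv by (auto simp: X_def p v_def)
    next
      case 3
      from assms(11)[OF this] ij have "real j < real A powr log (real n / real m) (real n / real i) *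
            real B powr (1 - log (real n / real m) (real n / real i))"
        unfolding A_def B_def by (meson le_less_trans of_nat_le_iff)
      from edge_inequality[OF m 3 _ A(2) B(2) this] ij show ?thesis
        by (simp add: X_def p u_def)
    qed
  qed
  let ?K = "lex_key (\<lambda>_. 0) (\<lambda>_. 0)"
  have lead_u: "leading (?K (-1)) (bsupport f) u"
    using uS supp m by (force simp: leading_def lex_key_def u_def A_def le_less)
  have lead_v: "leading (?K 1) (bsupport f) v"
    using vS supp m by (force simp: leading_def lex_key_def v_def B_def le_less)
  note key0 = multiplicative_key_lex_key[OF additive_on_pairs_zero additive_on_pairs_zero]
  show ?thesis
    unfolding bdirichlet_irreducible_def
  proof
    assume "\<exists>g h. bdirichlet_poly g \<and> bdirichlet_poly h \<and>
          \<not> bdirichlet_constant g \<and> \<not> bdirichlet_constant h \<and> f = bdirichlet_mult g h"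
    then obtain g h where g: "bdirichlet_poly g" "\<not> bdirichlet_constant g"
      and h: "bdirichlet_poly h" "\<not> bdirichlet_constant h" and fgh: "f = bdirichlet_mult g h"
      by blast
    \<comment> \<open>Primitivity concerns left factors; commutativity extends it to
      \<open>h\<close>.\<close>
    have g1: "\<not> single_term g" and h1: "\<not> single_term h"
      using assms(8) g h fgh bdirichlet_mult_commute[of g h]
      unfolding algebraically_primitive_def by metis+
    have fin: "finite (bsupport g)" "finite (bsupport h)"
      and pos: "bsupport g \<subseteq> pos_pairs" "bsupport h \<subseteq> pos_pairs"
      using g h by (auto simp: bdirichlet_poly_iff)
    have ne: "bsupport g \<noteq> {}" "bsupport h \<noteq> {}"
      using g h by (auto simp: bdirichlet_constant_def)
    obtain ug where ug: "leading (?K (-1)) (bsupport g) ug"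
      using leading_exists[OF fin(1) ne(1)] by blast
    obtain vg where vg: "leading (?K 1) (bsupport g) vg"
      using leading_exists[OF fin(1) ne(1)] by blast
    obtain uh where uh: "leading (?K (-1)) (bsupport h) uh"
      using leading_exists[OF fin(2) ne(2)] by blast
    obtain vh where vh: "leading (?K 1) (bsupport h) vh"
      using leading_exists[OF fin(2) ne(2)] by blast
    have in_pos: "ug \<in> pos_pairs" "vg \<in> pos_pairs" "uh \<in> pos_pairs" "vh \<in> pos_pairs"
      using ug vg uh vh pos by (auto simp: leading_def)
    have posf: "bsupport f \<subseteq> pos_pairs"
      using supp m by (force simp: pos_pairs_def)
    have u_eq: "pmul ug uh = u"
      by (rule leading_unique[OF key0 posf _ lead_u]) (use leading_mult[OF key0 g(1) h(1) ug uh] fgh in auto)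
    have v_eq: "pmul vg vh = v"
      by (rule leading_unique[OF key0 posf _ lead_v]) (use leading_mult[OF key0 g(1) h(1) vg vh] fgh in auto)
    have ltg: "fst ug < fst vg"
      using single_term_if_leading_eq[OF g(1) ug vg] g1 by linarith
    have lth: "fst uh < fst vh"
      using single_term_if_leading_eq[OF h(1) uh vh] h1 by linarith
    have parallel: "(ln n - ln m) * (Y vg - Y ug) = (ln (fst vg) - ln (fst ug)) * (Y v - Y u)"
      if Y: "additive_on_pairs Y" for Y
    proof -
      \<comment> \<open>The multiple of \<open>ln (fst p)\<close> is chosen to make \<open>Z\<close>
        agree at \<open>u\<close> and \<open>v\<close>, so that \<open>edge_factor\<close> applies
        to it.\<close>
      define Z where "Z = (\<lambda>p. (ln n - ln m) * Y p + (Y u - Y v) * ln (real (fst p)))"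
      have "additive_on_pairs Z"
        unfolding Z_def by (intro additive_on_pairs_lincomb additive_on_pairs_ln Y)
      moreover have "Z u = Z v" by (simp add: Z_def u_def v_def algebra_simps)
      ultimately have "Z ug = Z vg"
        using edge_factor[OF addX _ g(1) h(1) refl lead_u[unfolded fgh] lead_v[unfolded fgh]
            Xuv _ _ ug vg uh vh] edge fgh by blast
      then show ?thesis by (simp add: Z_def algebra_simps)
    qed
    \<comment> \<open>The ratio of the two edge vectors, measured by the logarithm of the first
      index; \<open>parallel\<close> makes it the same for every additive functional.\<close>
    define \<theta> where "\<theta> = (ln (fst vg) - ln (fst ug)) / (ln n - ln m)"
    have lnpos: "0 < ln (real n) - ln (real m)" using m mn by simp
    have \<theta>Y: "\<theta> * (Y v - Y u) = Y vg - Y ug" if "additive_on_pairs Y" for Y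
      using parallel[OF that] lnpos by (simp add: \<theta>_def field_simps)
    have prod: "n = fst vg * fst vh" "m = fst ug * fst uh"
      using u_eq v_eq by (auto simp: pmul_def u_def v_def)
    have gp: "0 < fst vg" "0 < fst ug" "0 < fst vh" "0 < fst uh"
      using in_pos by (auto simp: pos_pairs_def)
    have "ln n = ln (fst vg) + ln (fst vh)" "ln m = ln (fst ug) + ln (fst uh)"
      unfolding prod using gp by (simp_all add: ln_mult)
    moreover have "ln (real (fst ug)) < ln (real (fst vg))" "ln (real (fst uh)) < ln (real (fst vh))"
      using ltg lth gp by auto
    \<comment> \<open>Positivity comes from \<open>ltg\<close>. The complement
      \<open>1 - \<theta>\<close> is the corresponding ratio for \<open>h\<close>, positive by
      \<open>lth\<close>.\<close>
    ultimately have \<theta>_range: "0 < \<theta>" "\<theta> < 1"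
      using lnpos by (auto simp: \<theta>_def field_simps)
    define D where "D k l = {int (multiplicity p k) - int (multiplicity p l) | p. prime p \<and> p dvd k * l}"
      for k l :: nat
    have "gcd (Gcd (D m n)) (Gcd (D A B)) = 1"
      using assms(9,10,12) by (simp add: valuation_gcd_def D_def A_def B_def)
    moreover have "\<theta> * of_int d \<in> \<int>" if "d \<in> D m n \<union> D A B" for d
    proof -
      \<comment> \<open>\<open>Y\<close> is the valuation at \<open>p\<close> of the first or second
        index, hence integral on terms. The minus sign appears because \<open>D\<close> subtracts in
        the order \<open>u\<close> minus \<open>v\<close>.\<close>
      have "\<exists>Y. additive_on_pairs Y \<and> Y v - Y u = - of_int d \<and> Y vg - Y ug \<in> \<int>"
      proof (cases "d \<in> D m n")
        case True
        then obtain p where p: "prime p" "d = int (multiplicity p m) - int (multiplicity p n)"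
          by (auto simp: D_def)
        show ?thesis
          by (rule exI, rule conjI, rule additive_on_pairs_multiplicity(1)[OF p(1)])
            (simp add: p u_def v_def)
      next
        case False
        with that obtain p where p: "prime p" "d = int (multiplicity p A) - int (multiplicity p B)"
          by (auto simp: D_def)
        show ?thesis
          by (rule exI, rule conjI, rule additive_on_pairs_multiplicity(2)[OF p(1)])
            (simp add: p u_def v_def)
      qed
      then obtain Y where Y: "additive_on_pairs Y" "Y v - Y u = - of_int d" "Y vg - Y ug \<in> \<int>"
        by blast
      have "\<theta> * of_int d = - (Y vg - Y ug)"
        using \<theta>Y[OF Y(1)] Y(2) by simp
      with Y(3) show ?thesis by (metis Ints_minus)
    qed
    ultimately have "\<theta> \<in> \<int>" by (rule integral_scaling_of_coprime)
    with \<theta>_range show False by (auto elim!: Ints_cases)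
  qed
qed

end
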